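(* Let $M$ be a one-sided Turing machine with tape alphabet $\{0,1\}$, and let $f$ be the partial function on $\mathbb{N}$ computed by $M$ with binary input and binary output (conventions below). Then $f$ consists of strips of functions of the form $y \mapsto a + y$. Precisely: for every $i \in \mathbb{N}$ on which $f$ is defined, there is an integer $b \geq 1$ such that for every $x \in \mathbb{N}$, $f$ is defined on $i + b\cdot x$ and $$f(i + b\cdot x) = (i + b\cdot x) + a_i, \qquad \text{where } a_i = f(i) - i \in \mathbb{Z}.$$ That is, the restriction of $f$ to the strip $\{i + b\cdot x \mid x \in \mathbb{N}\}$ is the function $y \mapsto y + a_i$.
   Context: A one-sided Turing machine has finitely many states, tape alphabet $\{0,1\}$ (with $0$ the blank), and a tape that is infinite to the left but bounded on the right: there is a rightmost cell. A deterministic transition table maps each pair (state, symbol read) to a triple (symbol to write, move left or right, next state). At each step the machine reads the cell under the head, writes a symbol, moves the head one cell and changes state. There is no halting state: the computation halts exactly when the head is on the rightmost cell and is instructed to move right, so that it drops off the tape. Binary input/output convention: the input $n \in \mathbb{N}$ is written on the tape in binary, with its least significant bit in the rightmost cell and all other cells $0$. The head starts on the rightmost cell in a fixed initial state. If the computation halts, the output is the natural number whose binary representation is the final tape content (least significant bit in the rightmost cell; the content is $0$ in all but finitely many cells). $f(n)$ is this output if the computation on $n$ halts and is undefined otherwise. A strip is a subset of $\mathbb{N}$ of the form $\{a + b\cdot n \mid n \in \mathbb{N}\}$ for fixed natural numbers $a, b$. A strip of a function $f$ is the restriction of $f$ to a subdomain that is a strip. *)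

theory Defs
  imports Main
begin

datatype move = MoveLeft | MoveRight

text \<open>The tape alphabet is \<^typ>\<open>bool\<close>, with \<^term>\<open>False\<close> for the blank symbol 0 and
  \<^term>\<open>True\<close> for 1. The states of a machine are the elements of a finite type.\<close>

record 'q tm =
  start :: 'q
  delta :: "'q \<Rightarrow> bool \<Rightarrow> bool \<times> move \<times> 'q"

text \<open>Cells are numbered from right to left: cell 0 is the rightmost cell, and
  cell \<^term>\<open>Suc p\<close> is the left neighbour of cell \<^term>\<open>p\<close>. So cell \<^term>\<open>p\<close> holds the
  binary digit of weight \<open>2 ^ p\<close>.\<close>

type_synonym tape = "nat \<Rightarrow> bool"

datatype 'q config =
    Running (state: 'q) (head: nat) (contents: tape)
  | Halted (contents: tape)

text \<open>The machine still writes in the step in which it drops off the tape.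
  Halted configurations are fixed points of the step function.\<close>

fun step :: "'q tm \<Rightarrow> 'q config \<Rightarrow> 'q config" where
  "step M (Running q p t) =
    (case delta M q (t p) of
       (s, MoveLeft, q') \<Rightarrow> Running q' (Suc p) (t(p := s))
     | (s, MoveRight, q') \<Rightarrow>
         (if p = 0 then Halted (t(p := s)) else Running q' (p - 1) (t(p := s))))"
| "step M (Halted t) = Halted t"

definition initial :: "'q tm \<Rightarrow> nat \<Rightarrow> 'q config" where
  "initial M n = Running (start M) 0 (bit n)"

definition halts_with :: "'q tm \<Rightarrow> nat \<Rightarrow> tape \<Rightarrow> bool" where
  "halts_with M n t \<longleftrightarrow> (\<exists>k. (step M ^^ k) (initial M n) = Halted t)"

definition tape_value :: "tape \<Rightarrow> nat" where
  "tape_value t = (THE m. bit m = t)"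

definition computed :: "'q tm \<Rightarrow> nat \<rightharpoonup> nat" where
  "computed M n =
    (if \<exists>t. halts_with M n t then Some (tape_value (THE t. halts_with M n t)) else None)"

text \<open>The definite descriptions above are well defined: a final tape is unique, and it is
  the binary representation of a natural number.\<close>

lemma tape_value_bit [simp]: "tape_value (bit m) = m"
  unfolding tape_value_def by (rule the_equality) (auto intro: bit_eqI)

lemma step_Halted_funpow: "(step M ^^ k) (Halted t) = Halted t"
  by (induction k) auto

lemma halts_with_unique:
  assumes "halts_with M n t" "halts_with M n t'"
  shows "t = t'"
proof -
  obtain j k where j: "(step M ^^ j) (initial M n) = Halted t"
    and k: "(step M ^^ k) (initial M n) = Halted t'"
    using assms by (auto simp: halts_with_def)
  have "(step M ^^ (k + j)) (initial M n) = Halted t"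
    by (simp only: funpow_add comp_apply j step_Halted_funpow)
  moreover have "(step M ^^ (j + k)) (initial M n) = Halted t'"
    by (simp only: funpow_add comp_apply k step_Halted_funpow)
  ultimately show ?thesis by (simp add: add.commute)
qed

lemma fun_upd_bit_nat: "\<exists>m'::nat. (bit (m::nat))(p := s) = bit m'"
proof
  show "(bit m)(p := s) = bit (if s then set_bit p m else unset_bit p m)"
    by (auto simp: fun_eq_iff bit_simps)
qed

lemma halts_with_bit:
  assumes "halts_with M n t"
  shows "\<exists>m::nat. t = bit m"
proof -
  have step: "\<exists>m::nat. contents (step M c) = bit m" if "\<exists>m::nat. contents c = bit m"
    for c :: "'a config"
    using that by (cases c) (auto split: prod.splits move.splits intro: fun_upd_bit_nat)
  have "\<exists>m::nat. contents ((step M ^^ k) (initial M n)) = bit m" for k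
    by (induction k) (auto simp: initial_def intro: step)
  moreover obtain k where "(step M ^^ k) (initial M n) = Halted t"
    using assms by (auto simp: halts_with_def)
  ultimately show ?thesis by (metis config.sel(4))
qed

lemma computed_eq_Some_iff: "computed M n = Some m \<longleftrightarrow> halts_with M n (bit m)"
proof
  assume L: "computed M n = Some m"
  then obtain t where t: "halts_with M n t" by (auto simp: computed_def split: if_splits)
  then have "(THE t. halts_with M n t) = t" using halts_with_unique by blast
  with L t have "m = tape_value t" by (auto simp: computed_def split: if_splits)
  moreover obtain m' :: nat where "t = bit m'" using halts_with_bit[OF t] by blast
  ultimately show "halts_with M n (bit m)" using t by simp
next
  assume R: "halts_with M n (bit m)"
  then have "(THE t. halts_with M n t) = bit m" using halts_with_unique by blast
  with R show "computed M n = Some m" by (auto simp: computed_def)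
qed

end

theory Submission imports Defs begin

text \<open>A halting computation of \<open>k\<close> steps visits only the cells below \<open>k\<close>. Replacing the other
  cells by arbitrary contents therefore changes neither the run nor those contents. So with
  \<open>b = 2 ^ k\<close>, adding \<open>b * x\<close> to the input adds \<open>b * x\<close> to the output.\<close>

text \<open>With \<open>k\<close> counting the steps still to run, \<open>p + k\<close> never grows,
  since the head moves one cell per step. So \<open>p < N\<close> whenever a step remains, and every
  read and write falls inside \<open>{..<N}\<close>.\<close>

lemma halted_override_on:
  assumes "(step M ^^ k) (Running q p t) = Halted u" and "p + k \<le> N"
  shows "(step M ^^ k) (Running q p (override_on h t {..<N})) = Halted (override_on h u {..<N})"
  using assms
proof (induction k arbitrary: q p t)
  case 0
  then show ?case by simp
next
  case (Suc k)
  obtain s d q' where \<delta>: "delta M q (t p) = (s, d, q')"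
    by (cases "delta M q (t p)") auto
  have "p < N"
    using Suc.prems by simp
  then have read: "override_on h t {..<N} p = t p"
    by simp
  have upd: "(override_on h t {..<N})(r := s) = override_on h (t(r := s)) {..<N}" if "r < N" for r
    using that by (auto simp: override_on_def fun_eq_iff)
  show ?case
  proof (cases d)
    case MoveLeft
    then show ?thesis
      using Suc.prems
      by (auto simp add: funpow_Suc_right \<delta> upd read simp del: funpow.simps intro!: Suc.IH)
  next
    case MoveRight
    \<comment> \<open>The head may drop off with steps to spare; these fix the halted
      configuration.\<close>
    then show ?thesis
      using Suc.prems
      by (auto simp add: funpow_Suc_right step_Halted_funpow \<delta> upd read
          simp del: funpow.simps split: if_splits intro!: Suc.IH)
  qed
qed

text \<open>A multiple of \<open>2 ^ N\<close> has only zeros below position \<open>N\<close>, so no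
  carry leaves the low digits and the quotients simply add.\<close>

lemma bit_add_mult_exp_nat:
  fixes m x :: nat
  shows "bit (m + 2 ^ N * x) p \<longleftrightarrow>
    (if p < N then bit m p else bit (m div 2 ^ N + x) (p - N))"
proof (cases "p < N")
  case True
  have "take_bit N (m + 2 ^ N * x) = take_bit N m"
    by (simp add: take_bit_eq_mod)
  with True show ?thesis
    by (metis bit_take_bit_iff)
next
  case False
  have "drop_bit N (m + 2 ^ N * x) = m div 2 ^ N + x"
    by (simp add: drop_bit_eq_div)
  with False show ?thesis
    by (metis bit_drop_bit_eq comp_apply le_add_diff_inverse not_less)
qed

theorem theorem1:
  fixes M :: "'q::finite tm" and i v :: nat
  assumes "computed M i = Some v"
  shows "\<exists>b::nat. b \<ge> 1 \<and>
    (\<forall>x::nat. \<exists>w. computed M (i + b * x) = Some w \<and>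
      int w = int (i + b * x) + (int v - int i))"
proof -
  from assms obtain k where run: "(step M ^^ k) (Running (start M) 0 (bit i)) = Halted (bit v)"
    by (auto simp: computed_eq_Some_iff halts_with_def initial_def)
  note run' = halted_override_on[OF run, of k, simplified]
  \<comment> \<open>Overriding the input by itself gives the same run, whose unique result shows
    that the cells from \<open>k\<close> on are untouched.\<close>
  have "override_on (bit i) (bit i) {..<k} = bit i"
    by (simp add: override_on_def fun_eq_iff)
  with run run'[of "bit i"] have "bit v = override_on (bit i) (bit v) {..<k}"
    by simp
  then have "bit v p = bit i p" if "k \<le> p" for p
    using that by (metis lessThan_iff not_less override_on_apply_notin)
  \<comment> \<open>With equal quotients, adding \<open>2 ^ k * x\<close> to \<open>i\<close> and to
    \<open>v\<close> yields the same digits from \<open>k\<close> on, carries included.\<close>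
  then have high: "v div 2 ^ k = i div 2 ^ k"
    by (simp add: bit_eq_iff bit_drop_bit_eq flip: drop_bit_eq_div)
  have "computed M (i + 2 ^ k * x) = Some (v + 2 ^ k * x)" for x
  proof -
    have "override_on (bit (i + 2 ^ k * x)) (bit i) {..<k} = bit (i + 2 ^ k * x)"
      "override_on (bit (i + 2 ^ k * x)) (bit v) {..<k} = bit (v + 2 ^ k * x)"
      by (auto simp: override_on_def fun_eq_iff bit_add_mult_exp_nat high)
    with run'[of "bit (i + 2 ^ k * x)"] show ?thesis
      by (auto simp: computed_eq_Some_iff halts_with_def initial_def)
  qed
  then show ?thesis
    by (intro exI[of _ "2 ^ k"]) auto
qed

end
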